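(* Let $\lambda/\mu$ be a Young diagram (left-justified or shifted, possibly skew) and let $P_{\lambda/\mu}$ be the corresponding poset. If $P_{\lambda/\mu}$ is not a chain, then $P_{\lambda/\mu}$ is $1/3$-balanced.
   Context: An integer partition $\lambda=(\lambda_1,\dots,\lambda_k)$ is a weakly decreasing sequence of positive integers; it is strict if $\lambda_1>\lambda_2>\cdots>\lambda_k$. The (left-justified) diagram of $\lambda$ is the set of cells $\{(i,j):1\le i\le k,\ 1\le j\le\lambda_i\}$. For a strict partition $\lambda$, its shifted diagram is $\{(i,j):1\le i\le k,\ i\le j\le i+\lambda_i-1\}$ (row $i$ begins at the diagonal cell $(i,i)$). If $\mu=(\mu_1,\dots,\mu_l)\subseteq\lambda$ (i.e. $l\le k$ and $\mu_i\le\lambda_i$ for all $i\le l$), the skew diagram $\lambda/\mu$ is the set-theoretic difference of the diagram of $\lambda$ and the diagram of $\mu$, taken either both left-justified or both shifted (in the shifted case $\lambda,\mu$ strict); when $\mu$ is empty, $\lambda/\mu=\lambda$. The poset $P_{\lambda/\mu}$ has the cells of the diagram as elements with $(i,j)\le(i',j')$ iff $i\le i'$ and $j\le j'$. For distinct $x,y$ in a finite poset $P$, $\mathbb{P}(x\prec y)$ is the proportion of linear extensions of $P$ (total orders compatible with the partial order) in which $x$ comes before $y$; $P$ is $1/3$-balanced if there are distinct $x,y$ with $1/3\le\mathbb{P}(x\prec y)\le2/3$. *)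

theory Defs
  imports Complex_Main
begin

definition int_partition :: "nat list \<Rightarrow> bool" where
  "int_partition lam \<longleftrightarrow> sorted_wrt (\<ge>) lam \<and> (\<forall>p\<in>set lam. 0 < p)"

definition strict_partition :: "nat list \<Rightarrow> bool" where
  "strict_partition lam \<longleftrightarrow> int_partition lam \<and> sorted_wrt (>) lam"

definition contained_in :: "nat list \<Rightarrow> nat list \<Rightarrow> bool" where
  "contained_in mu lam \<longleftrightarrow>
     length mu \<le> length lam \<and> (\<forall>i<length mu. mu ! i \<le> lam ! i)"

text \<open>Cells are pairs (row, column) counted from 1, whereas list positions are counted
  from 0: row \<open>i\<close> has length \<open>lam ! (i - 1)\<close>.\<close>

definition diagram :: "nat list \<Rightarrow> (nat \<times> nat) set" where
  "diagram lam = {(i, j). 1 \<le> i \<and> i \<le> length lam \<and> 1 \<le> j \<and> j \<le> lam ! (i - 1)}"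

definition shifted_diagram :: "nat list \<Rightarrow> (nat \<times> nat) set" where
  "shifted_diagram lam =
     {(i, j). 1 \<le> i \<and> i \<le> length lam \<and> i \<le> j \<and> j \<le> i + lam ! (i - 1) - 1}"

text \<open>A finite poset is given by its carrier \<open>A\<close> and its reflexive order relation
  \<open>r \<subseteq> A \<times> A\<close>, as in \<^const>\<open>partial_order_on\<close>.\<close>

definition cell_order :: "(nat \<times> nat) set \<Rightarrow> ((nat \<times> nat) \<times> (nat \<times> nat)) set" where
  "cell_order D =
     {((i, j), (i', j')). (i, j) \<in> D \<and> (i', j') \<in> D \<and> i \<le> i' \<and> j \<le> j'}"

definition linear_extensions :: "'a set \<Rightarrow> ('a \<times> 'a) set \<Rightarrow> ('a \<times> 'a) set set" where
  "linear_extensions A r = {L. linear_order_on A L \<and> r \<subseteq> L}"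

text \<open>Linear extensions are reflexive, so \<open>(x, y) \<in> L\<close> says that \<open>x\<close> comes
  before \<open>y\<close> only for distinct \<open>x\<close> and \<open>y\<close>; it is used for such pairs only.\<close>

definition prob_before :: "'a set \<Rightarrow> ('a \<times> 'a) set \<Rightarrow> 'a \<Rightarrow> 'a \<Rightarrow> real" where
  "prob_before A r x y =
     real (card {L \<in> linear_extensions A r. (x, y) \<in> L}) /
     real (card (linear_extensions A r))"

definition one_third_balanced :: "'a set \<Rightarrow> ('a \<times> 'a) set \<Rightarrow> bool" where
  "one_third_balanced A r \<longleftrightarrow>
     (\<exists>x\<in>A. \<exists>y\<in>A. x \<noteq> y \<and> 1 / 3 \<le> prob_before A r x y \<and> prob_before A r x y \<le> 2 / 3)"

end

theory Submission
  imports Defs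
begin

text \<open>Two elements with the same strict lower set, each of whose upper sets exceeds the other in a
  chain, are almost twins; by an exchange argument, a poset with almost twins is
  \<open>1/3\<close>-balanced. In a diagram, two consecutive minimal cells \<open>z\<close> (upper right) and \<open>z'\<close>
  (lower left) are almost twins unless the rows of \<open>z\<close> above \<open>z'\<close> or the columns of \<open>z'\<close> left of
  \<open>z\<close> fail to be a chain. If both obstructions, one towards each neighbour, occur at the same minimal
  cell, then the cells to its right and below it are almost twins. At the two ends of the sequence
  of minimal cells one obstruction is enough to give almost twins (possibly the cell two steps to
  the right and the next diagonal cell, in the shifted case), so following the minimal cells from
  one end to the other must produce a pair.\<close>

section \<open>Almost twin pairs\<close>

text \<open>For reflexive \<open>r\<close> each difference contains its own base point, so
  \<open>x\<close> and \<open>y\<close> are the least elements of the two chains. Equal strict lower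
  sets make \<open>x\<close> and \<open>y\<close> incomparable.\<close>

definition almost_twins :: "'a set \<Rightarrow> ('a \<times> 'a) set \<Rightarrow> 'a \<Rightarrow> 'a \<Rightarrow> bool" where
  "almost_twins A r x y \<longleftrightarrow> x \<in> A \<and> y \<in> A \<and> x \<noteq> y \<and>
     (\<forall>z. (z, x) \<in> r \<and> z \<noteq> x \<longleftrightarrow> (z, y) \<in> r \<and> z \<noteq> y) \<and>
     total_on (r `` {x} - r `` {y}) r \<and> total_on (r `` {y} - r `` {x}) r"

lemma almost_twins_sym: "almost_twins A r x y \<Longrightarrow> almost_twins A r y x"
  unfolding almost_twins_def by blast

lemma finite_total_on_sorted_list:
  assumes "finite C" "total_on C r" "trans r"
  shows "\<exists>xs. set xs = C \<and> distinct xs \<and> sorted_wrt (\<lambda>u v. (u, v) \<in> r) xs"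
  using assms(1,2)
proof (induction C)
  case empty
  then show ?case by simp
next
  case (insert a C)
  then obtain xs where xs: "set xs = C" "distinct xs" "sorted_wrt (\<lambda>u v. (u, v) \<in> r) xs"
    by (meson subset_insertI total_on_subset)
  let ?ys = "filter (\<lambda>v. (v, a) \<in> r) xs @ a # filter (\<lambda>v. (v, a) \<notin> r) xs"
  have above: "(a, v) \<in> r" if "v \<in> C" "(v, a) \<notin> r" for v
    using insert.prems insert.hyps that unfolding total_on_def by auto
  have "sorted_wrt (\<lambda>u v. (u, v) \<in> r) ?ys"
    using xs above transD[OF \<open>trans r\<close>]
    by (auto simp: sorted_wrt_append sorted_wrt_filter)
  moreover have "set ?ys = insert a C" "distinct ?ys"
    using xs insert.hyps by auto
  ultimately show ?case by blast
qed

section \<open>Linear extensions and the exchange of two elements\<close>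

lemma finite_linear_extensions:
  assumes "finite A"
  shows "finite (linear_extensions A r)"
proof (rule finite_subset)
  show "linear_extensions A r \<subseteq> Pow (A \<times> A)"
    unfolding linear_extensions_def linear_order_on_def partial_order_on_def preorder_on_def
    by blast
qed (use assms in simp)

lemma linear_order_on_permute:
  assumes L: "linear_order_on A L" and \<pi>: "\<And>u. \<pi> (\<pi> u) = u" "\<And>u. u \<in> A \<Longrightarrow> \<pi> u \<in> A"
  shows "linear_order_on A {(u, v). (\<pi> u, \<pi> v) \<in> L}"
proof -
  have inj: "\<pi> u = \<pi> v \<longleftrightarrow> u = v" and mem: "\<pi> u \<in> A \<longleftrightarrow> u \<in> A" for u v
    by (metis \<pi>(1)) (metis \<pi>)
  have "L \<subseteq> A \<times> A" "refl_on A L" "trans L" "antisym L" "total_on A L"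
    using L unfolding linear_order_on_def partial_order_on_def preorder_on_def by auto
  then show ?thesis
    unfolding linear_order_on_def partial_order_on_def preorder_on_def
    by (auto simp: refl_on_def total_on_def inj subset_iff intro!: transI antisymI
        dest: transD antisymD) (metis mem)+
qed

text \<open>The exchange moves \<open>c\<close> up to the place of \<open>y\<close> and
  \<open>y\<close> down to the place of \<open>c\<close>. Only relations upward from
  \<open>c\<close> and downward from \<open>y\<close> are at risk, and \<open>up\<close> and
  \<open>down\<close> secure these.\<close>

lemma swap_linear_extension:
  assumes L: "L \<in> linear_extensions A r" and r: "partial_order_on A r"
    and cy: "c \<in> A" "y \<in> A" "c \<noteq> y" "(c, y) \<in> L" "(c, y) \<notin> r"
    and up: "\<And>z. (c, z) \<in> r \<Longrightarrow> z \<noteq> c \<Longrightarrow> (y, z) \<in> L"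
    and down: "\<And>z. (z, y) \<in> r \<Longrightarrow> z \<noteq> y \<Longrightarrow> (z, c) \<in> L"
  defines "\<pi> \<equiv> id(c := y, y := c)"
  shows "{(u, v). (\<pi> u, \<pi> v) \<in> L} \<in> linear_extensions A r"
proof -
  have lin: "linear_order_on A L" and sub: "r \<subseteq> L"
    using L unfolding linear_extensions_def by auto
  then have tr: "trans L" and rf: "refl_on A L"
    unfolding linear_order_on_def partial_order_on_def preorder_on_def by auto
  have rA: "r \<subseteq> A \<times> A" and anti: "antisym L"
    using r lin unfolding linear_order_on_def partial_order_on_def preorder_on_def by auto
  have "(\<pi> u, \<pi> v) \<in> L" if uv: "(u, v) \<in> r" for u v
  proof -
    have "u \<in> A" "v \<in> A" "(u, v) \<in> L" using uv rA sub by auto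
    consider "u = v" | "u \<noteq> v" "u = c" | "u \<noteq> v" "u = y" | "u \<noteq> v" "u \<noteq> c" "u \<noteq> y" by blast
    then show ?thesis
    proof cases
      case 1
      then show ?thesis using \<open>u \<in> A\<close> rf cy unfolding \<pi>_def refl_on_def by simp
    next
      case 2
      then show ?thesis using uv up[of v] cy unfolding \<pi>_def by auto
    next
      case 3
      then have "v \<noteq> c"
        using \<open>(u, v) \<in> L\<close> cy antisymD[OF anti] by blast
      then show ?thesis using 3 \<open>(u, v) \<in> L\<close> cy transD[OF tr] unfolding \<pi>_def by auto
    next
      case 4
      then show ?thesis using \<open>(u, v) \<in> L\<close> uv cy down[of u] transD[OF tr] unfolding \<pi>_def by auto
    qed
  qed
  moreover have "linear_order_on A {(u, v). (\<pi> u, \<pi> v) \<in> L}"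
    using cy by (intro linear_order_on_permute[OF lin]) (auto simp: \<pi>_def)
  ultimately show ?thesis unfolding linear_extensions_def by auto
qed

lemma linear_extension_flip:
  assumes "L \<in> linear_extensions A r" "u \<in> A" "v \<in> A" "u \<noteq> v"
  shows "(v, u) \<in> L \<longleftrightarrow> (u, v) \<notin> L"
  using assms unfolding linear_extensions_def linear_order_on_def partial_order_on_def
    antisym_def total_on_def by blast

text \<open>List the elements above \<open>x\<close> but not above \<open>y\<close> as \<open>x = c\<^sub>0 < \<dots> < c\<^sub>n\<close>. Exchanging \<open>y\<close> and
  \<open>c\<^sub>i\<close> shows that it becomes ever less likely for \<open>y\<close> to fall just above \<open>c\<^sub>i\<close> as \<open>i\<close> grows.
  Hence the probabilities that \<open>y\<close> precedes \<open>c\<^sub>i\<close> rise to \<open>1\<close> in steps no larger than their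
  initial value, which is below \<open>1/3\<close>, and cannot jump over the interval from \<open>1/3\<close> to \<open>2/3\<close>.\<close>

lemma balanced_element_above_twin:
  assumes r: "partial_order_on A r" and "finite A" and twins: "almost_twins A r x y"
  defines "E \<equiv> linear_extensions A r"
  assumes few: "3 * card {L \<in> E. (y, x) \<in> L} < card E"
  shows "\<exists>c\<in>A. c \<noteq> y \<and> card E \<le> 3 * card {L \<in> E. (y, c) \<in> L} \<and>
    3 * card {L \<in> E. (y, c) \<in> L} \<le> 2 * card E"
proof -
  define C where "C = r `` {x} - r `` {y}"
  have xy: "x \<in> A" "y \<in> A" "x \<noteq> y" and same: "\<And>z. (z, x) \<in> r \<and> z \<noteq> x \<longleftrightarrow> (z, y) \<in> r \<and> z \<noteq> y"
    and tot: "total_on C r"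
    using twins unfolding almost_twins_def C_def by blast+
  have rA: "r \<subseteq> A \<times> A" and rf: "refl_on A r" and tr: "trans r" and anti: "antisym r"
    using r unfolding partial_order_on_def preorder_on_def by auto
  have "C \<subseteq> A" using rA C_def by auto
  then have "finite C" using \<open>finite A\<close> finite_subset by auto
  have inc: "(x, y) \<notin> r" "(y, x) \<notin> r" using same xy by blast+
  have "x \<in> C" using xy rf inc unfolding C_def refl_on_def by auto
  have yC: "y \<notin> C" using C_def xy inc by auto
  obtain xs where xs: "set xs = C" "distinct xs" "sorted_wrt (\<lambda>u v. (u, v) \<in> r) xs"
    using finite_total_on_sorted_list[OF \<open>finite C\<close> tot tr] by blast
  define c where "c i = xs ! i" for i
  obtain n where n: "length xs = Suc n" using xs \<open>x \<in> C\<close>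
    by (metis length_pos_if_in_set gr0_conv_Suc)
  have cC: "c i \<in> C" if "i \<le> n" for i using that xs n unfolding c_def by auto
  have cA: "c i \<in> A" if "i \<le> n" for i using cC[OF that] \<open>C \<subseteq> A\<close> by auto
  have cy: "c i \<noteq> y" if "i \<le> n" for i using cC[OF that] yC by auto
  have Cc: "\<exists>i\<le>n. z = c i" if "z \<in> C" for z
    using that xs n unfolding c_def by (metis in_set_conv_nth less_Suc_eq_le)
  have mono: "(c i, c j) \<in> r" if "i < j" "j \<le> n" for i j
    using that xs n unfolding c_def by (simp add: sorted_wrt_iff_nth_less)
  have c_inj: "c i \<noteq> c j" if "i < j" "j \<le> n" for i j
    using that xs n unfolding c_def by (simp add: nth_eq_iff_index_eq)
  have c0: "c 0 = x"
  proof -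
    obtain i where i: "i \<le> n" "x = c i" using Cc \<open>x \<in> C\<close> by blast
    have "(x, c 0) \<in> r" using cC[of 0] C_def by auto
    moreover have "(c 0, x) \<in> r" if "i > 0" using mono[OF that i(1)] i by simp
    ultimately show ?thesis using i antisymD[OF anti] by (cases "i = 0") auto
  qed
  have xc: "(x, c i) \<in> r" if "i \<le> n" for i using cC[OF that] C_def by auto
  have cyr: "(c i, y) \<notin> r" "(y, c i) \<notin> r" if "i \<le> n" for i
    using cC[OF that] inc transD[OF tr xc[OF that]] unfolding C_def by auto
  have finE: "finite E" unfolding E_def using finite_linear_extensions[OF \<open>finite A\<close>] .
  have trE: "trans L" and rE: "r \<subseteq> L" if "L \<in> E" for L
    using that unfolding E_def linear_extensions_def linear_order_on_def partial_order_on_def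
      preorder_on_def by auto
  have flip: "(c i, y) \<in> L \<longleftrightarrow> (y, c i) \<notin> L" if "L \<in> E" "i \<le> n" for L i
    using linear_extension_flip[of L A r y "c i"] that cA cy xy unfolding E_def by auto
  define F where "F i = {L \<in> E. (y, c i) \<in> L}" for i
  \<comment> \<open>\<open>G i\<close> collects the extensions in which \<open>y\<close> falls
    between \<open>c (i - 1)\<close> and \<open>c i\<close>; there is no lower bound for
    \<open>i = 0\<close> and no upper bound for \<open>i = Suc n\<close>.\<close>
  define G where "G i = {L \<in> E. (i \<le> n \<longrightarrow> (y, c i) \<in> L) \<and> (i > 0 \<longrightarrow> (c (i - 1), y) \<in> L)}" for i
  have G_dec: "card (G (Suc i)) \<le> card (G i)" if i: "i \<le> n" for i
  proof -
    define \<pi> where "\<pi> = id(c i := y, y := c i)"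
    define f where "f L = {(u, v). (\<pi> u, \<pi> v) \<in> L}" for L
    have "\<pi> (\<pi> u) = u" for u unfolding \<pi>_def by auto
    then have "f (f L) = L" for L unfolding f_def by auto
    then have "inj_on f (G (Suc i))" by (metis inj_onI)
    moreover have "f L \<in> G i" if "L \<in> G (Suc i)" for L
    proof -
      have LE: "L \<in> E" and ciy: "(c i, y) \<in> L" and nxt: "Suc i \<le> n \<Longrightarrow> (y, c (Suc i)) \<in> L"
        using that unfolding G_def by auto
      \<comment> \<open>An element above \<open>c i\<close> is above \<open>y\<close> or is a later
        \<open>c j\<close>, and \<open>y\<close> precedes \<open>c (Suc i)\<close> in
        \<open>L\<close>. An element strictly below \<open>y\<close> is below \<open>x\<close>,
        hence below \<open>c i\<close>.\<close>
      have "f L \<in> E" unfolding E_def f_def \<pi>_def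
      proof (rule swap_linear_extension)
        show "L \<in> linear_extensions A r" using LE E_def by simp
        show "(y, z) \<in> L" if z: "(c i, z) \<in> r" "z \<noteq> c i" for z
        proof (cases "(y, z) \<in> r")
          case True
          then show ?thesis using rE[OF LE] by auto
        next
          case False
          have "(x, z) \<in> r" using transD[OF tr xc[OF i] z(1)] .
          then obtain j where j: "j \<le> n" "z = c j" using False Cc unfolding C_def by blast
          then have "i < j"
            using z mono[of j i] i antisymD[OF anti] by (metis linorder_neqE_nat)
          show ?thesis
          proof (cases "j = Suc i")
            case True
            then show ?thesis using nxt j by auto
          next
            case False
            then have "(c (Suc i), c j) \<in> L" using mono[of "Suc i" j] \<open>i < j\<close> j rE[OF LE] by auto
            moreover have "(y, c (Suc i)) \<in> L" using nxt \<open>i < j\<close> j by auto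
            ultimately show ?thesis using transD[OF trE[OF LE]] j by blast
          qed
        qed
        show "(z, c i) \<in> L" if "(z, y) \<in> r" "z \<noteq> y" for z
        proof -
          have "(z, x) \<in> r" using same that by blast
          then show ?thesis using transD[OF tr _ xc[OF i]] rE[OF LE] by blast
        qed
      qed (use r i ciy cA cy cyr xy in auto)
      moreover have "(y, c i) \<in> f L" using ciy cy[OF i] unfolding f_def \<pi>_def by auto
      moreover have "(c (i - 1), y) \<in> f L" if "i > 0"
        using mono[of "i - 1" i] c_inj[of "i - 1" i] cy[of "i - 1"] that i rE[OF LE]
        unfolding f_def \<pi>_def by auto
      ultimately show ?thesis unfolding G_def by simp
    qed
    ultimately show ?thesis
      using card_inj_on_le[of f "G (Suc i)" "G i"] finE unfolding G_def by auto
  qed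
  have G0: "G 0 = F 0" unfolding G_def F_def by auto
  have G_le: "card (G i) \<le> card (F 0)" if "i \<le> Suc n" for i
    using that
  proof (induction i)
    case (Suc i)
    then show ?case using G_dec[of i] by simp
  qed (simp add: G0)
  have F_step: "card (F (Suc i)) \<le> card (F i) + card (F 0)" if "Suc i \<le> n" for i
  proof -
    have "F (Suc i) \<subseteq> F i \<union> G (Suc i)" using flip[of _ i] that unfolding F_def G_def by auto
    then have "card (F (Suc i)) \<le> card (F i \<union> G (Suc i))"
      using finE by (intro card_mono) (auto simp: F_def G_def)
    also have "\<dots> \<le> card (F i) + card (G (Suc i))" by (rule card_Un_le)
    finally show ?thesis using G_le[of "Suc i"] that by simp
  qed
  have "card E \<le> card (F n) + card (F 0)"
  proof -
    \<comment> \<open>In \<open>G (Suc n)\<close> the element \<open>y\<close> comes after the whole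
      chain, so \<open>card (F 0)\<close> also bounds the gap between \<open>F n\<close> and all of
      \<open>E\<close>.\<close>
    have "E \<subseteq> F n \<union> G (Suc n)" using flip[of _ n] unfolding F_def G_def by auto
    then have "card E \<le> card (F n \<union> G (Suc n))"
      using finE by (intro card_mono) (auto simp: F_def G_def)
    also have "\<dots> \<le> card (F n) + card (G (Suc n))" by (rule card_Un_le)
    finally show ?thesis using G_le[of "Suc n"] by simp
  qed
  moreover have F0: "3 * card (F 0) < card E" using few c0 unfolding F_def by simp
  ultimately have reach: "card E \<le> 3 * card (F n)" by linarith
  \<comment> \<open>At the first index to reach a third, the previous value and the step are both
    below a third, so the value stays below two thirds.\<close>
  define i where "i = (LEAST i. card E \<le> 3 * card (F i))"
  have i: "card E \<le> 3 * card (F i)" "i \<le> n" using reach unfolding i_def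
    by (auto intro: LeastI Least_le)
  have "i \<noteq> 0" using i F0 by (metis not_less)
  then obtain j where j: "i = Suc j" using not0_implies_Suc by blast
  then have "\<not> card E \<le> 3 * card (F j)"
    using not_less_Least[of j "\<lambda>i. card E \<le> 3 * card (F i)"] i_def by simp
  moreover have "card (F i) \<le> card (F j) + card (F 0)" using F_step[of j] i j by simp
  ultimately have "3 * card (F i) \<le> 2 * card E" using F0 by linarith
  then show ?thesis using i cA cy unfolding F_def by blast
qed

text \<open>If one order of \<open>x\<close> and \<open>y\<close> has probability below
  \<open>1/3\<close>, the preceding lemma applies to one of the two chains. Otherwise both are at
  least \<open>1/3\<close> and sum to \<open>1\<close>, so \<open>x\<close> and \<open>y\<close>
  themselves are a balanced pair.\<close>

lemma almost_twins_balanced: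
  assumes r: "partial_order_on A r" and fin: "finite A" and twins: "almost_twins A r x y"
    and ne: "linear_extensions A r \<noteq> {}"
  shows "one_third_balanced A r"
proof -
  let ?E = "linear_extensions A r"
  have finE: "finite ?E" using finite_linear_extensions[OF fin] .
  then have pos: "card ?E > 0" using ne by (simp add: card_gt_0_iff)
  have bal: "one_third_balanced A r"
    if "u \<in> A" "v \<in> A" "u \<noteq> v" "card ?E \<le> 3 * card {L \<in> ?E. (u, v) \<in> L}"
      "3 * card {L \<in> ?E. (u, v) \<in> L} \<le> 2 * card ?E" for u v
    unfolding one_third_balanced_def prob_before_def
    using that pos by (intro bexI[of _ u] bexI[of _ v]) (auto simp: field_simps)
  have xy: "x \<in> A" "y \<in> A" "x \<noteq> y" using twins unfolding almost_twins_def by auto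
  have "?E = {L \<in> ?E. (x, y) \<in> L} \<union> {L \<in> ?E. (y, x) \<in> L}"
    using linear_extension_flip[of _ A r x y] xy by auto
  then have sum: "card ?E \<le> card {L \<in> ?E. (x, y) \<in> L} + card {L \<in> ?E. (y, x) \<in> L}"
    by (metis card_Un_le)
  consider "3 * card {L \<in> ?E. (y, x) \<in> L} < card ?E" | "3 * card {L \<in> ?E. (x, y) \<in> L} < card ?E"
    | "card ?E \<le> 3 * card {L \<in> ?E. (x, y) \<in> L}" "card ?E \<le> 3 * card {L \<in> ?E. (y, x) \<in> L}"
    by linarith
  then show ?thesis
  proof cases
    case 1
    then show ?thesis using balanced_element_above_twin[OF r fin twins] bal xy by blast
  next
    case 2
    then show ?thesis
      using balanced_element_above_twin[OF r fin almost_twins_sym[OF twins]] bal xy by blast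
  next
    case 3
    have "card {L \<in> ?E. (x, y) \<in> L} + card {L \<in> ?E. (y, x) \<in> L}
        = card ({L \<in> ?E. (x, y) \<in> L} \<union> {L \<in> ?E. (y, x) \<in> L})"
      using finE linear_extension_flip[of _ A r x y] xy by (intro card_Un_disjoint[symmetric]) auto
    also have "\<dots> \<le> card ?E" using finE by (intro card_mono) auto
    finally show ?thesis using 3 bal[of x y] xy by linarith
  qed
qed

section \<open>Cells\<close>

lemma cell_order_iff [simp]:
  "((a, b), (c, d)) \<in> cell_order D \<longleftrightarrow> (a, b) \<in> D \<and> (c, d) \<in> D \<and> a \<le> c \<and> b \<le> d"
  unfolding cell_order_def by auto

lemma total_on_column:
  assumes "S \<subseteq> D" "\<And>a b. (a, b) \<in> S \<Longrightarrow> b = c"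
  shows "total_on S (cell_order D)"
proof (rule total_onI)
  fix x y assume "x \<in> S" "y \<in> S"
  moreover obtain a b a' b' where "x = (a, b)" "y = (a', b')" by fastforce
  ultimately show "(x, y) \<in> cell_order D \<or> (y, x) \<in> cell_order D"
    using assms(1) assms(2)[of a b] assms(2)[of a' b'] by auto
qed

lemma total_on_row:
  assumes "S \<subseteq> D" "\<And>a b. (a, b) \<in> S \<Longrightarrow> a = c"
  shows "total_on S (cell_order D)"
proof (rule total_onI)
  fix x y assume "x \<in> S" "y \<in> S"
  moreover obtain a b a' b' where "x = (a, b)" "y = (a', b')" by fastforce
  ultimately show "(x, y) \<in> cell_order D \<or> (y, x) \<in> cell_order D"
    using assms(1) assms(2)[of a b] assms(2)[of a' b'] by auto
qed

lemma partial_order_on_cell_order: "partial_order_on D (cell_order D)"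
  unfolding partial_order_on_def preorder_on_def
  by (auto simp: refl_on_def cell_order_def intro!: transI antisymI)

text \<open>Gives the proportions a nonzero denominator when \<open>D\<close> is finite. The witness
  reads the cells row by row.\<close>

lemma linear_extensions_cell_order_nonempty: "linear_extensions D (cell_order D) \<noteq> {}"
proof -
  define L where "L = {((a, b), (c, d)). (a, b) \<in> D \<and> (c, d) \<in> D \<and> (a < c \<or> a = c \<and> b \<le> d)}"
  have "linear_order_on D L"
    unfolding linear_order_on_def partial_order_on_def preorder_on_def L_def
    by (auto simp: refl_on_def total_on_def intro!: transI antisymI)
  moreover have "cell_order D \<subseteq> L" unfolding L_def cell_order_def by auto
  ultimately show ?thesis unfolding linear_extensions_def by blast
qed

text \<open>As \<open>j' < j\<close>, a cell above \<open>(i, j)\<close> in the order fails to be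
  above \<open>(i', j')\<close> only by lying in a row before \<open>i'\<close>; symmetrically for
  columns. So the two differences of upper sets are the two strips.\<close>

lemma almost_twin_cells:
  assumes "(i, j) \<in> D" "(i', j') \<in> D" "i < i'" "j' < j"
    and below: "\<And>a b. (a, b) \<in> D \<Longrightarrow>
      a \<le> i \<and> b \<le> j \<and> (a, b) \<noteq> (i, j) \<longleftrightarrow> a \<le> i' \<and> b \<le> j' \<and> (a, b) \<noteq> (i', j')"
    and rows: "total_on {(a, b) \<in> D. i \<le> a \<and> a < i' \<and> j \<le> b} (cell_order D)"
    and cols: "total_on {(a, b) \<in> D. i' \<le> a \<and> j' \<le> b \<and> b < j} (cell_order D)"
  shows "almost_twins D (cell_order D) (i, j) (i', j')"
proof -
  have "cell_order D `` {(i, j)} - cell_order D `` {(i', j')} = {(a, b) \<in> D. i \<le> a \<and> a < i' \<and> j \<le> b}"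
    "cell_order D `` {(i', j')} - cell_order D `` {(i, j)} = {(a, b) \<in> D. i' \<le> a \<and> j' \<le> b \<and> b < j}"
    using assms(1-4) by auto
  then show ?thesis
    using assms unfolding almost_twins_def by auto
qed

section \<open>Diagrams given by row intervals\<close>

text \<open>Row \<open>i\<close> occupies the columns from \<open>s i\<close> to \<open>e i\<close> and may be empty. The rows below row \<open>m\<close>
  are those beginning on the diagonal in a shifted diagram; for left-justified diagrams \<open>m = k\<close>.\<close>

locale row_shape =
  fixes k m :: nat and s e :: "nat \<Rightarrow> nat" and D :: "(nat \<times> nat) set"
  assumes D: "D = {(i, j). 1 \<le> i \<and> i \<le> k \<and> s i \<le> j \<and> j \<le> e i}"
    and m: "1 \<le> m" "m \<le> k"
    and e_antimono: "\<And>i j. 1 \<le> i \<Longrightarrow> i \<le> j \<Longrightarrow> j \<le> k \<Longrightarrow> e j \<le> e i"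
    and s_antimono: "\<And>i j. 1 \<le> i \<Longrightarrow> i \<le> j \<Longrightarrow> j \<le> m \<Longrightarrow> s j \<le> s i"
    and staircase: "\<And>i. m \<le> i \<Longrightarrow> i \<le> k \<Longrightarrow> s i = s m + (i - m)"
    and nonempty: "\<And>i. m < k \<Longrightarrow> m \<le> i \<Longrightarrow> i \<le> k \<Longrightarrow> s i \<le> e i"
begin

lemma mem_D: "(i, j) \<in> D \<longleftrightarrow> 1 \<le> i \<and> i \<le> k \<and> s i \<le> j \<and> j \<le> e i"
  unfolding D by simp

lemma finite_D: "finite D"
proof (rule finite_subset)
  show "D \<subseteq> {..k} \<times> {..e 1}"
    unfolding D using e_antimono[of 1] by (auto intro: order_trans)
qed simp

text \<open>The cell \<open>(p, s p)\<close> is then minimal in the poset: with \<open>t\<close> the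
  column of one minimal cell, it is the next one to the lower left. Rows after \<open>m\<close>
  contain no minimal cell.\<close>

definition min_row :: "nat \<Rightarrow> nat \<Rightarrow> bool" where
  "min_row p t \<longleftrightarrow> 1 \<le> p \<and> p \<le> m \<and> s p \<le> e p \<and> s p < t \<and>
     (\<forall>a. 1 \<le> a \<longrightarrow> a < p \<longrightarrow> s a \<le> e a \<longrightarrow> t \<le> s a)"

text \<open>The equality keeps row \<open>Suc p\<close> from putting further cells under
  \<open>(Suc p, s p)\<close> in the order.\<close>

definition corner :: "nat \<Rightarrow> bool" where
  "corner p \<longleftrightarrow> (p, s p) \<in> D \<and> (p, Suc (s p)) \<in> D \<and> (Suc p, s p) \<in> D \<and> s (Suc p) = s p"

lemma min_row_above: "min_row p t \<Longrightarrow> (a, b) \<in> D \<Longrightarrow> b < t \<Longrightarrow> p \<le> a"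
  unfolding min_row_def mem_D by (metis le_trans not_less)

text \<open>By \<open>Suc (s p) < t\<close> no row above \<open>p\<close> reaches these columns, so
  \<open>(p, s p)\<close> is the only cell strictly below either one. The differences of the upper
  sets lie in one row and in one column.\<close>

lemma corner_twins:
  assumes p: "min_row p t" "corner p" "Suc (s p) < t"
  shows "almost_twins D (cell_order D) (p, Suc (s p)) (Suc p, s p)"
proof (rule almost_twin_cells)
  show "total_on {(a, b) \<in> D. p \<le> a \<and> a < Suc p \<and> Suc (s p) \<le> b} (cell_order D)"
    "total_on {(a, b) \<in> D. Suc p \<le> a \<and> s p \<le> b \<and> b < Suc (s p)} (cell_order D)"
    by (auto simp: total_on_def)
  show "a \<le> p \<and> b \<le> Suc (s p) \<and> (a, b) \<noteq> (p, Suc (s p)) \<longleftrightarrow>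
      a \<le> Suc p \<and> b \<le> s p \<and> (a, b) \<noteq> (Suc p, s p)" if ab: "(a, b) \<in> D" for a b
  proof -
    have "p \<le> a" if "b \<le> Suc (s p)" using min_row_above[OF p(1) ab] that p(3) by linarith
    moreover have "s p \<le> b" if "a = p \<or> a = Suc p"
      using ab that p(2) unfolding mem_D corner_def by auto
    ultimately show ?thesis by (cases "a = p"; cases "a = Suc p") auto
  qed
qed (use p in \<open>auto simp: corner_def\<close>)

text \<open>Row \<open>Suc m\<close> starts in column \<open>Suc (s m)\<close>, so the cells
  strictly below either one are \<open>(m, s m)\<close> and \<open>(m, Suc (s m))\<close>.\<close>

lemma staircase_twins:
  assumes p: "min_row m t" "m < k" "s m + 2 < t" "s m + 2 \<le> e m"
  shows "almost_twins D (cell_order D) (m, s m + 2) (Suc m, Suc (s m))"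
proof (rule almost_twin_cells)
  have Sm: "s (Suc m) = Suc (s m)" using staircase[of "Suc m"] p by auto
  show "(m, s m + 2) \<in> D" using m p unfolding mem_D by auto
  show "(Suc m, Suc (s m)) \<in> D" using m p nonempty[of "Suc m"] Sm unfolding mem_D by auto
  show "total_on {(a, b) \<in> D. m \<le> a \<and> a < Suc m \<and> s m + 2 \<le> b} (cell_order D)"
    "total_on {(a, b) \<in> D. Suc m \<le> a \<and> Suc (s m) \<le> b \<and> b < s m + 2} (cell_order D)"
    by (auto simp: total_on_def)
  show "a \<le> m \<and> b \<le> s m + 2 \<and> (a, b) \<noteq> (m, s m + 2) \<longleftrightarrow>
      a \<le> Suc m \<and> b \<le> Suc (s m) \<and> (a, b) \<noteq> (Suc m, Suc (s m))" if ab: "(a, b) \<in> D" for a b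
  proof -
    have "m \<le> a" if "b \<le> s m + 2" using min_row_above[OF p(1) ab] that p(3) by linarith
    moreover have "s a \<le> b" using ab mem_D by auto
    ultimately show ?thesis using Sm by (cases "a = m"; cases "a = Suc m") auto
  qed
qed auto

text \<open>The hypothesis \<open>last\<close> makes \<open>(p, s p)\<close> the lower left end of
  the sequence of minimal cells. If row \<open>p\<close> is a single cell, all that remains lies in
  its column; otherwise the missing corner empties the later rows up to \<open>m\<close>.\<close>

lemma total_on_last_row:
  assumes p: "min_row p t" "\<not> corner p"
    and last: "\<And>a. p < a \<Longrightarrow> a \<le> m \<Longrightarrow> s a \<le> e a \<Longrightarrow> s p \<le> s a"
    and no_twins: "\<not> (\<exists>x y. almost_twins D (cell_order D) x y)"
  shows "total_on {(a, b) \<in> D. p \<le> a \<and> b < t} (cell_order D)"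
proof (cases "e p = s p")
  case True
  have "b = s p" if "(a, b) \<in> D" "p \<le> a" for a b
  proof -
    have ab: "1 \<le> a" "a \<le> k" "s a \<le> b" "b \<le> e a" using that mem_D by auto
    have "b \<le> s p" using e_antimono[of p a] p that ab True unfolding min_row_def by linarith
    moreover have "s p \<le> b"
    proof (cases "a \<le> m")
      case True
      then show ?thesis using last[of a] that ab by (cases "a = p") auto
    next
      case False
      then have "s m \<le> e m" "s m \<le> s a" using nonempty[of m] ab staircase[of a] by auto
      then show ?thesis using last[of m] p ab unfolding min_row_def
        by (cases "p = m") auto
    qed
    ultimately show ?thesis by simp
  qed
  then show ?thesis by (intro total_on_column[of _ _ "s p"]) auto
next
  case False
  have p1: "1 \<le> p" "p \<le> m" "s p \<le> e p" "s p < t" using p unfolding min_row_def by auto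
  have empty: "e a < s a" if a: "p < a" "a \<le> m" for a
  proof (rule ccontr)
    assume "\<not> e a < s a"
    then have "s p \<le> s a" "s a \<le> e a" using last[OF a] by auto
    moreover have "s a \<le> s (Suc p)" "s (Suc p) \<le> s p" "e a \<le> e (Suc p)"
      using s_antimono[of "Suc p" a] s_antimono[of p "Suc p"] e_antimono[of "Suc p" a] a p1 m
      by auto
    ultimately have "corner p"
      using p1 a m False unfolding corner_def mem_D by auto
    then show False using p by simp
  qed
  show ?thesis
  proof (cases "m < k")
    case False
    then have "a = p" if "(a, b) \<in> D" "p \<le> a" for a b
      using that empty[of a] m unfolding mem_D by fastforce
    then show ?thesis by (intro total_on_row[of _ _ p]) auto
  next
    case True
    then have [simp]: "p = m"
      using empty[of m] nonempty[of m] p1 by force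
    \<comment> \<open>As \<open>staircase_twins\<close> cannot apply, only \<open>(m, s m)\<close>,
      \<open>(m, Suc (s m))\<close> and \<open>(Suc m, Suc (s m))\<close> can remain, and these form
      a chain.\<close>
    have "t \<le> s m + 2 \<or> e m < s m + 2"
      using staircase_twins[of t] p True no_twins by force
    then have cells: "(a, b) = (m, s m) \<or> (a, b) = (m, Suc (s m)) \<or> (a, b) = (Suc m, Suc (s m))"
      if "(a, b) \<in> D" "m \<le> a" "b < t" for a b
      using that e_antimono[of m a] staircase[of a] m unfolding mem_D by auto
    show ?thesis
    proof (rule total_onI)
      fix x y assume "x \<in> {(a, b) \<in> D. p \<le> a \<and> b < t}" "y \<in> {(a, b) \<in> D. p \<le> a \<and> b < t}"
      moreover obtain a b a' b' where "x = (a, b)" "y = (a', b')" by fastforce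
      ultimately show "(x, y) \<in> cell_order D \<or> (y, x) \<in> cell_order D"
        using cells[of a b] cells[of a' b'] by auto
    qed
  qed
qed

text \<open>For \<open>t\<close> the column in which the preceding minimal cell lies, the set below is what the upper
  set of the minimal cell of row \<open>p\<close> contains beyond that of its predecessor, together with
  everything further left. The induction descends through the rows of the minimal cells.\<close>

lemma corner_or_total:
  assumes "min_row p t"
    and no_twins: "\<not> (\<exists>x y. almost_twins D (cell_order D) x y)"
  shows "corner p \<and> t = Suc (s p) \<or> total_on {(a, b) \<in> D. p \<le> a \<and> b < t} (cell_order D)"
  using assms(1)
proof (induction "m - p" arbitrary: p t rule: less_induct)
  case less
  note p = \<open>min_row p t\<close>
  then have p1: "1 \<le> p" "p \<le> m" "s p \<le> e p" "s p < t" unfolding min_row_def by auto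
  define next_row where "next_row a \<longleftrightarrow> p < a \<and> a \<le> m \<and> s a \<le> e a \<and> s a < s p" for a
  show ?case
  proof (cases "corner p \<or> (\<nexists>a. next_row a)")
    case True
    then show ?thesis
    proof (cases "corner p")
      case True
      then show ?thesis using corner_twins[OF p] p1 no_twins by fastforce
    next
      case False
      then show ?thesis using True total_on_last_row p no_twins
        unfolding next_row_def by (meson not_less)
    qed
  next
    case False
    define p' where "p' = (LEAST a. next_row a)"
    have "next_row p'" using False unfolding p'_def by (auto intro: LeastI)
    then have p': "p < p'" "p' \<le> m" "s p' \<le> e p'" "s p' < s p" unfolding next_row_def by auto
    have first: "s p \<le> s a" if "1 \<le> a" "a < p'" "s a \<le> e a" for a
    proof (cases "a \<le> p")
      case False
      have "\<not> next_row a" using not_less_Least[of a next_row] that p'_def by simp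
      then show ?thesis using False that p'(2) unfolding next_row_def by auto
    qed (use that s_antimono p1 in auto)
    have min': "min_row p' (s p)" using p' p1 first unfolding min_row_def by auto
    \<comment> \<open>This case is contradictory: without a corner at \<open>p\<close>, the
      consecutive minimal cells of rows \<open>p\<close> and \<open>p'\<close> are almost
      twins.\<close>
    have "almost_twins D (cell_order D) (p, s p) (p', s p')"
    proof (rule almost_twin_cells)
      show "(p, s p) \<in> D" "(p', s p') \<in> D" using p1 p' m mem_D by auto
      show "a \<le> p \<and> b \<le> s p \<and> (a, b) \<noteq> (p, s p) \<longleftrightarrow>
          a \<le> p' \<and> b \<le> s p' \<and> (a, b) \<noteq> (p', s p')" if ab: "(a, b) \<in> D" for a b
      proof -
        have "p \<le> a" if "b \<le> s p" using min_row_above[OF p ab] that p1 by linarith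
        moreover have "p' \<le> a" if "b < s p" using min_row_above[OF min' ab] that by linarith
        moreover have "s a \<le> b" using ab mem_D by auto
        ultimately show ?thesis using p' by (cases "a = p"; cases "a = p'") auto
      qed
      show "total_on {(a, b) \<in> D. p' \<le> a \<and> s p' \<le> b \<and> b < s p} (cell_order D)"
      proof -
        \<comment> \<open>This is the induction hypothesis with \<open>s p\<close> for
          \<open>t\<close>. A corner at \<open>p'\<close> leaves a strip only one column
          wide.\<close>
        consider "s p = Suc (s p')" | "total_on {(a, b) \<in> D. p' \<le> a \<and> b < s p} (cell_order D)"
          using less.hyps[OF _ min'] p' by fastforce
        then show ?thesis
          by cases (auto simp: total_on_def)
      qed
      show "total_on {(a, b) \<in> D. p \<le> a \<and> a < p' \<and> s p \<le> b} (cell_order D)"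
      proof (cases "e p = s p")
        case True
        then have "b = s p" if "(a, b) \<in> D" "p \<le> a" "s p \<le> b" for a b
          using that e_antimono[of p a] p1 unfolding mem_D by auto
        then show ?thesis by (intro total_on_column[of _ _ "s p"]) auto
      next
        case False
        \<comment> \<open>A nonempty row strictly between would start in column \<open>s p\<close>,
          squeezed by \<open>first\<close> and \<open>s_antimono\<close>; then so would row
          \<open>Suc p\<close>, giving a corner.\<close>
        have "a = p" if ab: "(a, b) \<in> D" "p \<le> a" "a < p'" for a b
        proof (rule ccontr)
          assume "a \<noteq> p"
          then have "s p \<le> s a" "s a \<le> e a" using ab first[of a] mem_D by auto
          moreover have "s a \<le> s (Suc p)" "s (Suc p) \<le> s p" "e a \<le> e (Suc p)"
            using s_antimono[of "Suc p" a] s_antimono[of p "Suc p"] e_antimono[of "Suc p" a]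
              ab p1 p' m \<open>a \<noteq> p\<close> by auto
          ultimately have "corner p"
            using p1 p' m False unfolding corner_def mem_D by auto
          then show False using \<open>\<not> (corner p \<or> (\<nexists>a. next_row a))\<close> by simp
        qed
        then show ?thesis by (intro total_on_row[of _ _ p]) auto
      qed
    qed (use p' in auto)
    then show ?thesis using no_twins by blast
  qed
qed

section \<open>From the topmost minimal cell to the whole diagram\<close>

lemma one_third_balanced_D:
  assumes "\<not> linear_order_on D (cell_order D)"
  shows "one_third_balanced D (cell_order D)"
proof -
  have not_total: "\<not> total_on D (cell_order D)"
    using assms partial_order_on_cell_order unfolding linear_order_on_def by blast
  then obtain a0 b0 where "(a0, b0) \<in> D" unfolding total_on_def by auto
  then have a0: "1 \<le> a0" "a0 \<le> k" "s a0 \<le> e a0" unfolding mem_D by auto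
  define row where "row a \<longleftrightarrow> 1 \<le> a \<and> a \<le> k \<and> s a \<le> e a" for a
  define p where "p = (LEAST a. row a)"
  have "row p" using a0 unfolding p_def row_def by (intro LeastI) auto
  have least: "p \<le> a" if "row a" for a using that unfolding p_def by (rule Least_le)
  have "p \<le> m"
  proof (rule ccontr)
    assume "\<not> p \<le> m"
    then have "row m" using \<open>row p\<close> m nonempty[of m] unfolding row_def by auto
    then show False using least \<open>\<not> p \<le> m\<close> by auto
  qed
  \<comment> \<open>This bound exceeds every column of \<open>D\<close>; the second
    \<open>Suc\<close> excludes the alternative \<open>t = Suc (s p)\<close> even when
    \<open>s p = e p\<close>.\<close>
  have "min_row p (Suc (Suc (e p)))"
    using \<open>row p\<close> \<open>p \<le> m\<close> least m unfolding min_row_def row_def by fastforce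
  moreover have "{(a, b) \<in> D. p \<le> a \<and> b < Suc (Suc (e p))} = D"
  proof -
    have "p \<le> a \<and> b \<le> e p" if "(a, b) \<in> D" for a b
      using that least[of a] e_antimono[of p a] \<open>row p\<close> unfolding mem_D row_def by auto
    then show ?thesis by fastforce
  qed
  ultimately obtain x y where "almost_twins D (cell_order D) x y"
    using corner_or_total not_total \<open>row p\<close> unfolding row_def by fastforce
  then show ?thesis
by (rule almost_twins_balanced[OF partial_order_on_cell_order finite_D _
        linear_extensions_cell_order_nonempty])
qed

end

section \<open>Young diagrams\<close>

lemma int_partition_nth_antimono:
  "int_partition lam \<Longrightarrow> i \<le> j \<Longrightarrow> j < length lam \<Longrightarrow> lam ! j \<le> lam ! i"
  unfolding int_partition_def by (cases "i = j") (auto simp: sorted_wrt_iff_nth_less)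

text \<open>The drop of at least one per part offsets the shift of each row by one, so the row ends
  of a shifted diagram weakly decrease.\<close>

lemma strict_partition_nth_gap:
  assumes "strict_partition lam" "i \<le> j" "j < length lam"
  shows "lam ! j + (j - i) \<le> lam ! i"
  using assms(2,3)
proof (induction j rule: dec_induct)
  case (step n)
  then have "lam ! Suc n < lam ! n"
    using assms(1) unfolding strict_partition_def by (auto simp: sorted_wrt_iff_nth_less)
  then show ?case using step by auto
qed simp

text \<open>Padding \<open>mu\<close> with zeros gives the row starts. Taking \<open>m = k\<close>
  leaves no staircase.\<close>

lemma straight_row_shape:
  assumes "int_partition lam" "int_partition mu" "contained_in mu lam" "lam \<noteq> []"
  shows "row_shape (length lam) (length lam) (\<lambda>i. Suc (if i \<le> length mu then mu ! (i - 1) else 0))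
    (\<lambda>i. lam ! (i - 1)) (diagram lam - diagram mu)"
proof
  show "diagram lam - diagram mu = {(i, j). 1 \<le> i \<and> i \<le> length lam \<and>
      Suc (if i \<le> length mu then mu ! (i - 1) else 0) \<le> j \<and> j \<le> lam ! (i - 1)}"
    unfolding diagram_def by (auto split: if_splits)
  show "1 \<le> length lam" using assms(4) by (cases lam) auto
qed (use assms(1,2) in \<open>auto intro!: int_partition_nth_antimono\<close>)

text \<open>Rows not met by \<open>mu\<close> start on the diagonal, so the staircase begins at row
  \<open>Suc (length mu)\<close>; \<open>min\<close> covers the case that \<open>mu\<close> meets
  every row.\<close>

lemma shifted_row_shape:
  assumes "strict_partition lam" "strict_partition mu" "contained_in mu lam" "lam \<noteq> []"
  shows "row_shape (length lam) (min (Suc (length mu)) (length lam))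
    (\<lambda>i. i + (if i \<le> length mu then mu ! (i - 1) else 0))
    (\<lambda>i. i + lam ! (i - 1) - 1) (shifted_diagram lam - shifted_diagram mu)"
proof
  have pos: "0 < lam ! i" if "i < length lam" for i
    using assms(1) that unfolding strict_partition_def int_partition_def by auto
  have mu_pos: "0 < mu ! i" if "i < length mu" for i
    using assms(2) that unfolding strict_partition_def int_partition_def by auto
  show "shifted_diagram lam - shifted_diagram mu = {(i, j). 1 \<le> i \<and> i \<le> length lam \<and>
      i + (if i \<le> length mu then mu ! (i - 1) else 0) \<le> j \<and> j \<le> i + lam ! (i - 1) - 1}"
    unfolding shifted_diagram_def by (auto split: if_splits)
  show "1 \<le> min (Suc (length mu)) (length lam)" using assms(4) by (cases lam) auto
  show "j + lam ! (j - 1) - 1 \<le> i + lam ! (i - 1) - 1" if "1 \<le> i" "i \<le> j" "j \<le> length lam" for i j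
  proof -
    have "lam ! (j - 1) + (j - 1 - (i - 1)) \<le> lam ! (i - 1)"
      using strict_partition_nth_gap[OF assms(1), of "i - 1" "j - 1"] that by auto
    then show ?thesis using that by linarith
  qed
  show "j + (if j \<le> length mu then mu ! (j - 1) else 0)
      \<le> i + (if i \<le> length mu then mu ! (i - 1) else 0)"
    if ij: "1 \<le> i" "i \<le> j" "j \<le> min (Suc (length mu)) (length lam)" for i j
  proof (cases "j \<le> length mu")
    case True
    have "mu ! (j - 1) + (j - 1 - (i - 1)) \<le> mu ! (i - 1)"
      using strict_partition_nth_gap[OF assms(2), of "i - 1" "j - 1"] True ij by auto
    then show ?thesis using True ij by auto
  next
    case False
    then have j: "j = Suc (length mu)" using ij by auto
    show ?thesis
    proof (cases "i = j")
      case False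
      then have "mu ! (length mu - 1) + (length mu - 1 - (i - 1)) \<le> mu ! (i - 1)"
        using strict_partition_nth_gap[OF assms(2), of "i - 1" "length mu - 1"] ij j by auto
      \<comment> \<open>The last part of \<open>mu\<close> must be positive for the start not to
        increase on entering the first diagonal row.\<close>
      moreover have "0 < mu ! (length mu - 1)" using mu_pos[of "length mu - 1"] False ij j by auto
      ultimately show ?thesis using False ij j by auto
    qed simp
  qed
  show "i + (if i \<le> length mu then mu ! (i - 1) else 0) \<le> i + lam ! (i - 1) - 1"
    if "min (Suc (length mu)) (length lam) < length lam"
      "min (Suc (length mu)) (length lam) \<le> i" "i \<le> length lam" for i
  proof -
    have "i - 1 < length lam" using that by linarith
    then have "0 < lam ! (i - 1)" by (rule pos)
    then show ?thesis using that by auto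
  qed
qed (use assms(3) in \<open>auto simp: contained_in_def\<close>)

theorem theorem4p1:
  fixes lam mu :: "nat list" and D :: "(nat \<times> nat) set"
  assumes "int_partition lam" and "int_partition mu" and "contained_in mu lam"
    and "D = diagram lam - diagram mu \<or>
         strict_partition lam \<and> strict_partition mu \<and>
         D = shifted_diagram lam - shifted_diagram mu"
    and "\<not> linear_order_on D (cell_order D)"
  shows "one_third_balanced D (cell_order D)"
proof -
  \<comment> \<open>A \<open>row_shape\<close> has at least one row; the empty diagram is linearly
    ordered.\<close>
  have "lam \<noteq> []"
  proof
    assume "lam = []"
    then have "D = {}" using assms(4) unfolding diagram_def shifted_diagram_def by auto
    then show False
      using assms(5) partial_order_on_cell_order unfolding linear_order_on_def by auto
  qed
  then show ?thesis
    using assms(4) row_shape.one_third_balanced_D[OF straight_row_shape]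
      row_shape.one_third_balanced_D[OF shifted_row_shape]
      assms(1,2,3,5) by blast
qed

end
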